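(* Let $R$ be an associative ring with unit element $1\neq 0$. Then for all $p\in\mathbb{P}(R)$, $$\#\{x\in\mathbb{P}(R)\mid x\parallel p\}=\#\,\mathrm{rad}\,R$$ (equality of cardinalities). In particular, the radical parallelism $\parallel$ on $\mathbb{P}(R)$ is the equality relation if, and only if, $\mathrm{rad}\,R=\{0\}$.
   Context: All rings are associative with unit element $1\neq 0$. $\mathrm{GL}_2(R)$ is the group of invertible $2\times 2$-matrices over $R$, acting from the right on row vectors in the free left $R$-module $R^2$. A pair $(a,b)\in R^2$ is admissible if it is the first row of some matrix in $\mathrm{GL}_2(R)$. The projective line over $R$ is $\mathbb{P}(R):=\{R(a,b)\mid (a,b)\in R^2 \text{ admissible}\}$, i.e. the orbit of the cyclic submodule $R(1,0)$ of $R^2$ under $\mathrm{GL}_2(R)$; points are always represented by admissible pairs. Two points $p=R(a,b)$, $q=R(c,d)$ (with $(a,b),(c,d)$ admissible) are called distant, written $p\mathrel{\triangle} q$, if $\begin{pmatrix}a&b\\c&d\end{pmatrix}\in\mathrm{GL}_2(R)$; equivalently, $\triangle$ is the orbit of the pair $(R(1,0),R(0,1))$ under $\mathrm{GL}_2(R)$. A point $p\in\mathbb{P}(R)$ is called radically parallel to a point $q\in\mathbb{P}(R)$, written $p\parallel q$, if for all $x\in\mathbb{P}(R)$: $x\mathrel{\triangle} p$ implies $x\mathrel{\triangle} q$. The Jacobson radical $\mathrm{rad}\,R$ is the intersection of all maximal left (equivalently, right) ideals of $R$. *)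

theory Defs
  imports "HOL-Analysis.Analysis" "HOL-Library.Equipollence"
begin

text \<open>
  The ring $R$ is a type \<open>'a\<close> of class \<open>ring_1\<close> (associative, unital, $1 \neq 0$, not necessarily
  commutative), and row vectors $(a,b)$ in $R^2$ are elements of \<open>'a^2\<close>, a left $R$-module
  under \<open>*s\<close>. The library predicate \<open>invertible\<close> asks for a two-sided inverse, so the matrices
  \<open>A :: 'a^2^2\<close> with \<open>invertible A\<close> form the group $GL_2(R)$.
\<close>

definition admissible_pair :: "'a::ring_1^2 \<Rightarrow> bool"
  where "admissible_pair v \<longleftrightarrow> (\<exists>A :: 'a^2^2. invertible A \<and> row 1 A = v)"

definition cyclic_submodule :: "'a::ring_1^2 \<Rightarrow> ('a^2) set"
  where "cyclic_submodule v = range (\<lambda>r. r *s v)"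

definition projective_line :: "('a::ring_1^2) set set"
  where "projective_line = {cyclic_submodule v | v. admissible_pair v}"

text \<open>
  Representatives are required to be admissible because over some rings a point is also
  generated by vectors that are not admissible.
\<close>

definition distant :: "('a::ring_1^2) set \<Rightarrow> ('a^2) set \<Rightarrow> bool"
  where "distant p q \<longleftrightarrow>
    (\<exists>u v. admissible_pair u \<and> admissible_pair v \<and>
       p = cyclic_submodule u \<and> q = cyclic_submodule v \<and>
       invertible (vector [u, v] :: 'a^2^2))"

definition radically_parallel :: "('a::ring_1^2) set \<Rightarrow> ('a^2) set \<Rightarrow> bool"
  where "radically_parallel p q \<longleftrightarrow>
    p \<in> projective_line \<and> q \<in> projective_line \<and>
    (\<forall>x\<in>projective_line. distant x p \<longrightarrow> distant x q)"

text \<open>Closure under negation follows from closure under left multiplication by \<open>-1\<close>.\<close>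

definition left_ideal :: "'a::ring_1 set \<Rightarrow> bool"
  where "left_ideal I \<longleftrightarrow>
    0 \<in> I \<and> (\<forall>x\<in>I. \<forall>y\<in>I. x + y \<in> I) \<and> (\<forall>r. \<forall>x\<in>I. r * x \<in> I)"

definition maximal_left_ideal :: "'a::ring_1 set \<Rightarrow> bool"
  where "maximal_left_ideal I \<longleftrightarrow>
    left_ideal I \<and> I \<noteq> UNIV \<and> (\<forall>J. left_ideal J \<and> I \<subseteq> J \<longrightarrow> J = I \<or> J = UNIV)"

definition jacobson_radical :: "'a::ring_1 set"
  where "jacobson_radical = \<Inter> {I. maximal_left_ideal I}"

end

theory Submission imports Defs begin

text \<open>
  $GL_2(R)$ acts transitively on points and preserves distance, so it suffices to look at
  $R(1,0)$. The points distant from $R(1,0)$ are the $R(s,1)$, and $R(s,1)$ is distant from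
  $R(c,d)$ iff $c - ds$ is a unit. Hence $R(1,0) \parallel R(c,d)$ iff $c - ds$ is a unit for
  all $s$, which after scaling to $c = 1$ says exactly that $d$ lies in the Jacobson radical.
  The points $R(1,d)$ are pairwise distinct, which counts the class of $R(1,0)$. Symmetry of
  the relation comes from translating $R(1,d)$ back to $R(1,0)$, which sends $R(1,0)$ to
  $R(1,-d)$.
\<close>

subsection \<open>The Jacobson radical\<close>

text \<open>A one-sided inverse need not be two-sided in a noncommutative ring, so a single
  \<open>y\<close> has to satisfy both equations.\<close>

definition two_sided_unit :: "'a::monoid_mult \<Rightarrow> bool"
  where "two_sided_unit x \<longleftrightarrow> (\<exists>y. x * y = 1 \<and> y * x = 1)"

text \<open>Left multiplication by a unit can be undone. This allows a generator of a point to be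
  rescaled by a unit without changing which of the elements \<open>c - d * s\<close> are
  units.\<close>

lemma two_sided_unit_mult_left_cancel:
  fixes x :: "'a::monoid_mult"
  assumes "two_sided_unit x"
  shows "two_sided_unit (x * y) \<longleftrightarrow> two_sided_unit y"
proof -
  obtain x' where x': "x * x' = 1" "x' * x = 1"
    using assms unfolding two_sided_unit_def by blast
  have cancel: "x' * (x * z) = z" "x * (x' * z) = z" for z
    using x' by (simp_all flip: mult.assoc)
  show ?thesis
  proof
    assume "two_sided_unit (x * y)"
    then obtain z where z: "x * y * z = 1" "z * (x * y) = 1"
      unfolding two_sided_unit_def by blast
    \<comment> \<open>Cancelling \<open>x\<close> in \<open>x * (y * z) = 1\<close> identifies
      \<open>y * z\<close> with the inverse of \<open>x\<close>, which makes \<open>z * x\<close> a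
      right inverse of \<open>y\<close>.\<close>
    have "y * z = x'"
      using z(1) cancel(1)[of "y * z"] by (simp add: mult.assoc)
    then have "y * (z * x) = 1"
      using x'(2) by (simp flip: mult.assoc)
    moreover have "z * x * y = 1"
      using z(2) by (simp add: mult.assoc)
    ultimately show "two_sided_unit y"
      unfolding two_sided_unit_def by blast
  next
    assume "two_sided_unit y"
    then obtain z where z: "y * z = 1" "z * y = 1"
      unfolding two_sided_unit_def by blast
    have "x * y * (z * x') = x * (y * z) * x'" "z * x' * (x * y) = z * (x' * (x * y))"
      by (simp_all only: mult.assoc)
    then show "two_sided_unit (x * y)"
      unfolding two_sided_unit_def using z x' cancel by (metis mult.right_neutral)
  qed
qed

lemma left_ideal_eq_UNIV_iff: "left_ideal I \<Longrightarrow> I = UNIV \<longleftrightarrow> 1 \<in> I"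
  unfolding left_ideal_def by (metis UNIV_I UNIV_eq_I mult.right_neutral)

text \<open>Krull's theorem for left ideals, by Zorn's lemma.\<close>

lemma ex_maximal_left_ideal_above:
  fixes I :: "'a::ring_1 set"
  assumes I: "left_ideal I" "I \<noteq> UNIV"
  obtains M where "maximal_left_ideal M" "I \<subseteq> M"
proof -
  \<comment> \<open>Properness is expressed by \<open>1 \<notin> J\<close>, a condition that passes
    to unions of chains.\<close>
  define \<A> where "\<A> = {J. left_ideal J \<and> 1 \<notin> J \<and> I \<subseteq> J}"
  have "\<exists>M\<in>\<A>. \<forall>J\<in>\<A>. M \<subseteq> J \<longrightarrow> J = M"
  proof (rule subset_Zorn_nonempty)
    show "\<A> \<noteq> {}"
      using I left_ideal_eq_UNIV_iff unfolding \<A>_def by blast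
    fix \<C> assume \<C>: "\<C> \<noteq> {}" "subset.chain \<A> \<C>"
    then have sub: "\<C> \<subseteq> \<A>" and tot: "\<And>X Y. X \<in> \<C> \<Longrightarrow> Y \<in> \<C> \<Longrightarrow> X \<subseteq> Y \<or> Y \<subseteq> X"
      unfolding subset_chain_def by auto
    have ideal: "left_ideal J" if "J \<in> \<C>" for J
      using that sub unfolding \<A>_def by blast
    have "left_ideal (\<Union>\<C>)"
      unfolding left_ideal_def
    proof (intro conjI ballI allI)
      show "0 \<in> \<Union>\<C>"
        using \<C>(1) ideal unfolding left_ideal_def by blast
      show "r * x \<in> \<Union>\<C>" if "x \<in> \<Union>\<C>" for r x
        using that ideal unfolding left_ideal_def by blast
      fix x y assume "x \<in> \<Union>\<C>" "y \<in> \<Union>\<C>"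
      then obtain X Y where XY: "X \<in> \<C>" "Y \<in> \<C>" "x \<in> X" "y \<in> Y"
        by blast
      \<comment> \<open>Members of a chain are comparable, so the larger of \<open>X\<close> and
        \<open>Y\<close> contains both elements.\<close>
      then have "\<exists>Z\<in>\<C>. x \<in> Z \<and> y \<in> Z"
        using tot[of X Y] by blast
      then show "x + y \<in> \<Union>\<C>"
        using ideal unfolding left_ideal_def by blast
    qed
    then show "\<Union>\<C> \<in> \<A>"
      using sub \<C>(1) unfolding \<A>_def by blast
  qed
  then obtain M where M: "M \<in> \<A>" "\<And>J. J \<in> \<A> \<Longrightarrow> M \<subseteq> J \<Longrightarrow> J = M"
    by blast
  have "maximal_left_ideal M"
    unfolding maximal_left_ideal_def
  proof (intro conjI allI impI)
    show "left_ideal M" "M \<noteq> UNIV"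
      using M(1) unfolding \<A>_def by auto
    fix J assume "left_ideal J \<and> M \<subseteq> J"
    then show "J = M \<or> J = UNIV"
      using M left_ideal_eq_UNIV_iff[of J] unfolding \<A>_def by blast
  qed
  then show ?thesis
    using that M(1) unfolding \<A>_def by blast
qed

text \<open>If \<open>1 - r * d\<close> has no left inverse, the left ideal it generates is proper
  and lies in a maximal one; that one also contains \<open>d\<close>, hence \<open>1\<close>.
  Conversely, if a maximal \<open>M\<close> misses \<open>d\<close>, then \<open>M\<close> and
  \<open>d\<close> together generate the ring, and \<open>1 = m + r * d\<close> puts the left
  invertible element \<open>1 - r * d\<close> into \<open>M\<close>.\<close>

lemma jacobson_radical_iff_left_inverse:
  fixes d :: "'a::ring_1"
  shows "d \<in> jacobson_radical \<longleftrightarrow> (\<forall>r. \<exists>u. u * (1 - r * d) = 1)"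
proof (intro iffI allI)
  fix r assume d: "d \<in> jacobson_radical"
  let ?I = "range (\<lambda>x. x * (1 - r * d))"
  have I: "left_ideal ?I"
    unfolding left_ideal_def
  proof (intro conjI ballI allI)
    show "0 \<in> ?I" by (rule range_eqI[of _ _ 0]) simp
    show "x + y \<in> ?I" if "x \<in> ?I" "y \<in> ?I" for x y
      using that by (auto simp flip: distrib_right)
    show "s * x \<in> ?I" if "x \<in> ?I" for s x
      using that by (auto simp flip: mult.assoc)
  qed
  show "\<exists>u. u * (1 - r * d) = 1"
  proof (rule ccontr)
    assume "\<not> ?thesis"
    then have "1 \<notin> ?I" by force
    then obtain M where M: "maximal_left_ideal M" "?I \<subseteq> M"
      using ex_maximal_left_ideal_above[OF I] by blast
    then have idM: "\<And>x y. x \<in> M \<Longrightarrow> y \<in> M \<Longrightarrow> x + y \<in> M" "\<And>r x. x \<in> M \<Longrightarrow> r * x \<in> M"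
      unfolding maximal_left_ideal_def left_ideal_def by auto
    have "1 - r * d \<in> M"
      using M(2) by (metis mult.left_neutral rangeI subsetD)
    moreover have "d \<in> M"
      using d M(1) unfolding jacobson_radical_def by blast
    ultimately have "(1 - r * d) + r * d \<in> M"
      using idM by blast
    then show False
      using M(1) left_ideal_eq_UNIV_iff[of M] unfolding maximal_left_ideal_def by simp
  qed
next
  assume inv: "\<forall>r. \<exists>u. u * (1 - r * d) = 1"
  show "d \<in> jacobson_radical"
    unfolding jacobson_radical_def
  proof (clarify, rule ccontr)
    fix M assume M: "maximal_left_ideal M" and dM: "d \<notin> M"
    then have idM: "0 \<in> M" "\<And>x y. x \<in> M \<Longrightarrow> y \<in> M \<Longrightarrow> x + y \<in> M" "\<And>r x. x \<in> M \<Longrightarrow> r * x \<in> M"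
      unfolding maximal_left_ideal_def left_ideal_def by auto
    \<comment> \<open>This is the left ideal generated by \<open>M\<close> and \<open>d\<close>;
      maximality of \<open>M\<close> will make it the whole ring.\<close>
    let ?J = "{m + r * d | m r. m \<in> M}"
    have "left_ideal ?J"
      unfolding left_ideal_def
    proof (intro conjI ballI allI)
      show "0 \<in> ?J" using idM(1) by (auto intro!: exI[of _ 0])
      show "x + y \<in> ?J" if "x \<in> ?J" "y \<in> ?J" for x y
      proof -
        obtain m r n s where "x = m + r * d" "y = n + s * d" "m \<in> M" "n \<in> M"
          using \<open>x \<in> ?J\<close> \<open>y \<in> ?J\<close> by blast
        then have "x + y = (m + n) + (r + s) * d" "m + n \<in> M"
          using idM(2) by (simp_all add: algebra_simps)
        then show ?thesis by blast
      qed
      show "s * x \<in> ?J" if "x \<in> ?J" for s x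
      proof -
        obtain m r where "x = m + r * d" "m \<in> M"
          using \<open>x \<in> ?J\<close> by blast
        then have "s * x = s * m + (s * r) * d" "s * m \<in> M"
          using idM(3) by (simp_all add: algebra_simps)
        then show ?thesis by blast
      qed
    qed
    moreover have "M \<subseteq> ?J"
      by (force intro: exI[of _ 0])
    moreover have "d \<in> ?J"
      using idM(1) by (force intro: exI[of _ 1])
    ultimately have "?J = UNIV"
      using M dM unfolding maximal_left_ideal_def by blast
    then obtain m r where mr: "1 = m + r * d" "m \<in> M"
      by blast
    then have "1 - r * d \<in> M"
      by (metis add_diff_cancel)
    then have "1 \<in> M"
      using inv idM(3) by metis
    then show False
      using M left_ideal_eq_UNIV_iff[of M] unfolding maximal_left_ideal_def by blast
  qed
qed

text \<open>With \<open>u\<close> the inverse of \<open>1 - a * b\<close>, expanding inverses as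
  formal geometric series suggests \<open>1 + b * u * a\<close> as the inverse of
  \<open>1 - b * a\<close>; a direct computation confirms it.\<close>

lemma two_sided_unit_one_minus_mult_swap:
  fixes a b :: "'a::ring_1"
  assumes "two_sided_unit (1 - a * b)"
  shows "two_sided_unit (1 - b * a)"
proof -
  obtain u where u: "(1 - a * b) * u = 1" "u * (1 - a * b) = 1"
    using assms unfolding two_sided_unit_def by blast
  have "(1 - b * a) * (1 + b * u * a) = 1 - b * a + b * ((1 - a * b) * u) * a"
    "(1 + b * u * a) * (1 - b * a) = 1 - b * a + b * (u * (1 - a * b)) * a"
    by (simp_all add: algebra_simps)
  then show ?thesis
    unfolding two_sided_unit_def using u by (intro exI[of _ "1 + b * u * a"]) simp
qed

text \<open>The left inverses of the earlier criterion turn out to be two-sided, and swapping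
  factors moves \<open>d\<close> to the left. In this form the radical matches the elements
  \<open>c - d * s\<close> that arise from distance.\<close>

lemma jacobson_radical_iff_two_sided_unit:
  fixes d :: "'a::ring_1"
  shows "d \<in> jacobson_radical \<longleftrightarrow> (\<forall>s. two_sided_unit (1 - d * s))"
proof
  assume "d \<in> jacobson_radical"
  then have left: "\<exists>u. u * (1 - r * d) = 1" for r
    using jacobson_radical_iff_left_inverse by blast
  show "\<forall>s. two_sided_unit (1 - d * s)"
  proof
    fix s
    obtain u where u: "u * (1 - s * d) = 1"
      using left by blast
    \<comment> \<open>The left inverse \<open>u\<close> is itself of the form \<open>1 - r * d\<close>, so it is left invertible too.\<close>
    have "u = 1 - (- (u * s)) * d"
      using u by (simp add: algebra_simps)
    then obtain v where v: "v * u = 1"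
      using left by metis
    have "v = 1 - s * d"
      using u v by (metis mult.assoc mult.left_neutral mult.right_neutral)
    then have "two_sided_unit (1 - s * d)"
      using u v unfolding two_sided_unit_def by blast
    then show "two_sided_unit (1 - d * s)"
      by (rule two_sided_unit_one_minus_mult_swap)
  qed
next
  assume "\<forall>s. two_sided_unit (1 - d * s)"
  then have "two_sided_unit (1 - r * d)" for r
    using two_sided_unit_one_minus_mult_swap by blast
  then show "d \<in> jacobson_radical"
    unfolding jacobson_radical_iff_left_inverse two_sided_unit_def by blast
qed

subsection \<open>The action of the general linear group\<close>

lemma row_matrix_mult: "row i (A ** B) = row i A v* B"
  by (simp add: vector_matrix_mult_def row_def matrix_matrix_mult_def)

text \<open>Scalars act from the left and matrices from the right, so the two actions commute by
  associativity. Hence matrices map cyclic submodules to cyclic submodules.\<close>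

lemma vector_matrix_mult_scaled: "(r *s v) v* A = r *s (v v* A)"
  by (simp add: vector_matrix_mult_def vec_eq_iff sum_distrib_left mult.assoc)

lemma image_vector_matrix_mult_cyclic_submodule:
  "(\<lambda>v. v v* A) ` cyclic_submodule v = cyclic_submodule (v v* A)"
  by (simp add: cyclic_submodule_def image_image vector_matrix_mult_scaled)

lemma vector_2_vector_matrix_mult:
  fixes A :: "'a::ring_1^2^2"
  shows "(vector [u v* A, v v* A] :: 'a^2^2) = vector [u, v] ** A"
  by (simp add: vec_eq_iff forall_2 vector_matrix_mult_def matrix_matrix_mult_def)

lemma admissible_pair_vector_matrix_mult:
  "admissible_pair v \<Longrightarrow> invertible A \<Longrightarrow> admissible_pair (v v* A)"
  unfolding admissible_pair_def by (metis invertible_mult row_matrix_mult)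

lemma projective_line_image:
  "p \<in> projective_line \<Longrightarrow> invertible A \<Longrightarrow> (\<lambda>v. v v* A) ` p \<in> projective_line"
  unfolding projective_line_def
  using admissible_pair_vector_matrix_mult image_vector_matrix_mult_cyclic_submodule by fastforce

lemma distant_image:
  assumes "distant p q" "invertible A"
  shows "distant ((\<lambda>v. v v* A) ` p) ((\<lambda>v. v v* A) ` q)"
proof -
  obtain u v where uv: "admissible_pair u" "admissible_pair v" "p = cyclic_submodule u"
    "q = cyclic_submodule v" "invertible (vector [u, v] :: 'a^2^2)"
    using assms(1) unfolding distant_def by blast
  then have "invertible (vector [u v* A, v v* A] :: 'a^2^2)"
    using assms(2) by (simp add: vector_2_vector_matrix_mult invertible_mult)
  then show ?thesis
    unfolding distant_def using uv assms(2)
    by (metis admissible_pair_vector_matrix_mult image_vector_matrix_mult_cyclic_submodule)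
qed

text \<open>Since the action is from the right, applying \<open>A\<close> first and \<open>B\<close>
  second is the action of \<open>A ** B\<close>.\<close>

lemma image_vector_matrix_mult_inverse:
  "A ** B = mat 1 \<Longrightarrow> (\<lambda>v. v v* B) ` (\<lambda>v. v v* A) ` p = p"
  by (simp add: image_image vector_matrix_mul_assoc)

text \<open>A test point \<open>x\<close> for the images is pulled back by the inverse matrix to a
  test point for \<open>p\<close> and \<open>q\<close>, because both directions of the action
  preserve distance.\<close>

lemma radically_parallel_image:
  assumes pq: "radically_parallel p q" and A: "invertible A"
  shows "radically_parallel ((\<lambda>v. v v* A) ` p) ((\<lambda>v. v v* A) ` q)"
proof -
  obtain B where AB: "A ** B = mat 1" "B ** A = mat 1"
    using A unfolding invertible_def by blast
  then have B: "invertible B"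
    unfolding invertible_def by blast
  have "distant x ((\<lambda>v. v v* A) ` q)"
    if x: "x \<in> projective_line" "distant x ((\<lambda>v. v v* A) ` p)" for x
  proof -
    have "distant ((\<lambda>v. v v* B) ` x) p"
      using distant_image[OF x(2) B] by (simp add: image_vector_matrix_mult_inverse[OF AB(1)])
    then have "distant ((\<lambda>v. v v* B) ` x) q"
      using pq projective_line_image[OF x(1) B] unfolding radically_parallel_def by blast
    from distant_image[OF this A] show ?thesis
      by (simp add: image_vector_matrix_mult_inverse[OF AB(2)])
  qed
  then show ?thesis
    using pq A unfolding radically_parallel_def by (blast intro: projective_line_image)
qed

subsection \<open>Distance in coordinates\<close>

lemma cyclic_submodule_scaled:
  assumes "two_sided_unit w"
  shows "cyclic_submodule (w *s v) = cyclic_submodule v"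
proof -
  obtain z where z: "z * w = 1"
    using assms unfolding two_sided_unit_def by blast
  have "r *s v = (r * z) *s (w *s v)" for r
    using z by (simp add: vector_smult_assoc mult.assoc)
  then show ?thesis
    unfolding cyclic_submodule_def by (auto simp: vector_smult_assoc)
qed

text \<open>Each of \<open>u\<close> and \<open>v\<close> is a multiple of the other. For an
  admissible \<open>x\<close> the equation \<open>x = r *s x\<close> forces \<open>r = 1\<close>,
  since an inverse matrix carries \<open>x\<close> to \<open>(1,0)\<close>; hence the two
  multipliers are mutually inverse.\<close>

lemma admissible_pair_unique_up_to_unit:
  fixes u v :: "'a::ring_1^2"
  assumes "admissible_pair u" "admissible_pair v" "cyclic_submodule u = cyclic_submodule v"
  obtains w where "two_sided_unit w" "u = w *s v"
proof -
  have annih: "r = 1" if "admissible_pair x" "x = r *s x" for r and x :: "'a^2"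
  proof -
    obtain A B :: "'a^2^2" where "row 1 A = x" "A ** B = mat 1"
      using \<open>admissible_pair x\<close> unfolding admissible_pair_def invertible_def by blast
    then have "x v* B = row 1 (mat 1)"
      by (metis row_matrix_mult)
    moreover have "x v* B = r *s (x v* B)"
      using vector_matrix_mult_scaled[of r x B] \<open>x = r *s x\<close> by simp
    ultimately have "row 1 (mat 1 :: 'a^2^2) $ 1 = (r *s row 1 (mat 1 :: 'a^2^2)) $ 1"
      by simp
    then show ?thesis
      by (simp add: row_def mat_def)
  qed
  have "u \<in> cyclic_submodule v" "v \<in> cyclic_submodule u"
    using assms(3) unfolding cyclic_submodule_def by (metis rangeI vector_smult_lid)+
  then obtain w z where wz: "u = w *s v" "v = z *s u"
    unfolding cyclic_submodule_def by blast
  then have "u = (w * z) *s u" "v = (z * w) *s v"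
    by (metis vector_smult_assoc)+
  then have "w * z = 1" "z * w = 1"
    using annih assms(1,2) by blast+
  then show ?thesis
    using that wz(1) unfolding two_sided_unit_def by blast
qed

section \<open>Invertibility of explicit two-by-two matrices\<close>

definition mat2 :: "'a \<Rightarrow> 'a \<Rightarrow> 'a \<Rightarrow> 'a \<Rightarrow> 'a::ring_1^2^2"
  where "mat2 a b c d = vector [vector [a, b], vector [c, d]]"

lemma mat2_mult:
  "mat2 a b c d ** mat2 a' b' c' d' =
     mat2 (a * a' + b * c') (a * b' + b * d') (c * a' + d * c') (c * b' + d * d')"
  by (simp add: mat2_def vec_eq_iff forall_2 matrix_matrix_mult_def sum_2)

lemma mat_1_eq_mat2: "mat 1 = mat2 1 0 0 1"
  by (simp add: mat2_def vec_eq_iff forall_2 mat_def)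

lemma mat2_eq_iff: "mat2 a b c d = mat2 a' b' c' d' \<longleftrightarrow> a = a' \<and> b = b' \<and> c = c' \<and> d = d'"
  by (auto simp: mat2_def vec_eq_iff forall_2)

lemma mat2_cases:
  fixes A :: "'a::ring_1^2^2"
  obtains a b c d where "A = mat2 a b c d"
proof
  show "A = mat2 (A $ 1 $ 1) (A $ 1 $ 2) (A $ 2 $ 1) (A $ 2 $ 2)"
    by (simp add: mat2_def vec_eq_iff forall_2)
qed

lemma vector_2_cases:
  fixes v :: "'a::ring_1^2"
  obtains a b where "v = vector [a, b]"
proof
  show "v = vector [v $ 1, v $ 2]"
    by (simp add: vec_eq_iff forall_2)
qed

lemma invertible_mat2_iff:
  "invertible (mat2 a b c d) \<longleftrightarrow>
    (\<exists>a' b' c' d'. mat2 a b c d ** mat2 a' b' c' d' = mat 1 \<and>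
       mat2 a' b' c' d' ** mat2 a b c d = mat 1)"
  unfolding invertible_def by (metis mat2_cases)

text \<open>The row \<open>(1,0)\<close> forces the first row of an inverse to be
  \<open>(0,1)\<close>; the remaining equations say that its lower left entry inverts
  \<open>t\<close>. This decides when a point is distant from \<open>R(1,0)\<close>.\<close>

lemma invertible_mat2_lower_10: "invertible (mat2 s t 1 0) \<longleftrightarrow> two_sided_unit t"
proof
  assume "invertible (mat2 s t 1 0)"
  then show "two_sided_unit t"
    unfolding invertible_mat2_iff two_sided_unit_def
    by (auto simp: mat2_mult mat_1_eq_mat2 mat2_eq_iff)
next
  assume "two_sided_unit t"
  then obtain t' where "t * t' = 1" "t' * t = 1"
    unfolding two_sided_unit_def by blast
  then show "invertible (mat2 s t 1 0)"
    unfolding invertible_mat2_iff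
    by (intro exI[of _ 0] exI[of _ 1] exI[of _ t'] exI[of _ "- (t' * s)"])
      (simp add: mat2_mult mat_1_eq_mat2 flip: mult.assoc)
qed

text \<open>Here the row \<open>(0,1)\<close> forces the second row of an inverse to be
  \<open>(1,0)\<close>, and its upper right entry must invert \<open>c\<close>.\<close>

lemma invertible_mat2_upper_01: "invertible (mat2 0 1 c d) \<longleftrightarrow> two_sided_unit c"
proof
  assume "invertible (mat2 0 1 c d)"
  then show "two_sided_unit c"
    unfolding invertible_mat2_iff two_sided_unit_def
    by (auto simp: mat2_mult mat_1_eq_mat2 mat2_eq_iff)
next
  assume "two_sided_unit c"
  then obtain c' where "c * c' = 1" "c' * c = 1"
    unfolding two_sided_unit_def by blast
  then show "invertible (mat2 0 1 c d)"
    unfolding invertible_mat2_iff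
    by (intro exI[of _ "- (c' * d)"] exI[of _ c'] exI[of _ 1] exI[of _ 0])
      (simp add: mat2_mult mat_1_eq_mat2 flip: mult.assoc)
qed

lemma invertible_mat2_lower_unitriangular: "invertible (mat2 1 0 s 1)"
  unfolding invertible_mat2_iff
  by (intro exI[of _ 1] exI[of _ 0] exI[of _ "- s"] exI[of _ 1])
    (simp add: mat2_mult mat_1_eq_mat2)

lemma invertible_mat2_upper_unitriangular: "invertible (mat2 1 d 0 1)"
  unfolding invertible_mat2_iff
  by (intro exI[of _ 1] exI[of _ "- d"] exI[of _ 0] exI[of _ 1])
    (simp add: mat2_mult mat_1_eq_mat2)

text \<open>Subtracting the second column times \<open>s\<close> from the first clears the entry
  \<open>s\<close> and leaves \<open>c - d * s\<close> below it. The column operation is an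
  invertible right factor.\<close>

lemma invertible_mat2_upper_s1: "invertible (mat2 s 1 c d) \<longleftrightarrow> two_sided_unit (c - d * s)"
proof -
  have "mat2 s 1 c d = mat2 0 1 (c - d * s) d ** mat2 1 0 s 1"
    and "mat2 0 1 (c - d * s) d = mat2 s 1 c d ** mat2 1 0 (- s) 1"
    by (simp_all add: mat2_mult)
  then have "invertible (mat2 s 1 c d) \<longleftrightarrow> invertible (mat2 0 1 (c - d * s) d)"
    by (metis invertible_mult invertible_mat2_lower_unitriangular)
  then show ?thesis
    by (simp add: invertible_mat2_upper_01)
qed

text \<open>Distance only asks for some pair of generators with an invertible matrix. Any other
  admissible generators differ by units, which multiply that matrix from the left by an invertible
  diagonal one.\<close>

lemma distant_cyclic_submodule_iff:
  fixes u v :: "'a::ring_1^2"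
  assumes uv: "admissible_pair u" "admissible_pair v"
  shows "distant (cyclic_submodule u) (cyclic_submodule v) \<longleftrightarrow>
    invertible (vector [u, v] :: 'a^2^2)"
proof
  assume "invertible (vector [u, v] :: 'a^2^2)"
  then show "distant (cyclic_submodule u) (cyclic_submodule v)"
    unfolding distant_def using uv by blast
next
  assume "distant (cyclic_submodule u) (cyclic_submodule v)"
  then obtain u' v' where uv': "admissible_pair u'" "admissible_pair v'"
    "cyclic_submodule u = cyclic_submodule u'" "cyclic_submodule v = cyclic_submodule v'"
    "invertible (vector [u', v'] :: 'a^2^2)"
    unfolding distant_def by blast
  obtain w z where w: "two_sided_unit w" "u = w *s u'" and z: "two_sided_unit z" "v = z *s v'"
    using admissible_pair_unique_up_to_unit uv uv' by metis
  obtain w' z' where "w * w' = 1" "w' * w = 1" "z * z' = 1" "z' * z = 1"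
    using w(1) z(1) unfolding two_sided_unit_def by blast
  then have "invertible (mat2 w 0 0 z)"
    unfolding invertible_mat2_iff
    by (intro exI[of _ w'] exI[of _ 0] exI[of _ 0] exI[of _ z'])
      (simp add: mat2_mult mat_1_eq_mat2)
  moreover have "(vector [u, v] :: 'a^2^2) = mat2 w 0 0 z ** vector [u', v']"
    by (simp add: w(2) z(2) mat2_def vec_eq_iff forall_2 matrix_matrix_mult_def sum_2)
  ultimately show "invertible (vector [u, v] :: 'a^2^2)"
    using uv'(5) by (simp add: invertible_mult)
qed

lemma admissible_pair_mat2: "invertible (mat2 a b c d) \<Longrightarrow> admissible_pair (vector [a, b])"
  unfolding admissible_pair_def
  by (intro exI[of _ "mat2 a b c d"]) (simp add: mat2_def row_def vec_eq_iff forall_2)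

lemma admissible_pair_1d: "admissible_pair (vector [1, d])"
  by (rule admissible_pair_mat2[OF invertible_mat2_upper_unitriangular])

lemma admissible_pair_s1: "admissible_pair (vector [s, 1])"
  by (rule admissible_pair_mat2[of _ _ 1 0]) (simp add: invertible_mat2_lower_10 two_sided_unit_def)

subsection \<open>Radical parallelism\<close>

abbreviation base_point :: "('a::ring_1^2) set"
  where "base_point \<equiv> cyclic_submodule (vector [1, 0])"

lemma cyclic_submodule_in_projective_line:
  "admissible_pair v \<Longrightarrow> cyclic_submodule v \<in> projective_line"
  unfolding projective_line_def by blast

lemma projective_line_cases:
  assumes "p \<in> projective_line"
  obtains a b where "admissible_pair (vector [a, b])" "p = cyclic_submodule (vector [a, b])"
proof -
  obtain v where "admissible_pair v" "p = cyclic_submodule v"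
    using assms unfolding projective_line_def by blast
  then show ?thesis
    using that by (cases v rule: vector_2_cases) blast
qed

text \<open>An admissible generator is the first row of some invertible \<open>A\<close>, that is,
  the image of \<open>(1,0)\<close> under \<open>A\<close>.\<close>

lemma projective_line_transitive:
  assumes "p \<in> projective_line"
  obtains A where "invertible A" "p = (\<lambda>v. v v* A) ` base_point"
proof -
  obtain A :: "'a^2^2" where A: "invertible A" "p = cyclic_submodule (row 1 A)"
    using assms unfolding projective_line_def admissible_pair_def by blast
  have "row 1 A = vector [1, 0] v* A"
    by (simp add: vector_matrix_mult_def row_def vec_eq_iff sum_2)
  then show ?thesis
    using that A by (simp add: image_vector_matrix_mult_cyclic_submodule)
qed

text \<open>Distance from \<open>R(1,0)\<close> makes the second coordinate a unit, and scaling by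
  its inverse turns that coordinate into \<open>1\<close>.\<close>

lemma distant_base_point_iff:
  assumes "x \<in> projective_line"
  shows "distant x base_point \<longleftrightarrow> (\<exists>s. x = cyclic_submodule (vector [s, 1]))"
proof
  obtain a b where ab: "admissible_pair (vector [a, b])" "x = cyclic_submodule (vector [a, b])"
    using assms by (rule projective_line_cases)
  assume "distant x base_point"
  then have "two_sided_unit b"
    using ab distant_cyclic_submodule_iff[OF ab(1) admissible_pair_1d]
    by (simp add: invertible_mat2_lower_10 flip: mat2_def)
  then obtain c where c: "c * b = 1" "two_sided_unit c"
    unfolding two_sided_unit_def by blast
  have "vector [c * a, 1] = c *s (vector [a, b] :: 'a^2)"
    using c by (simp add: vec_eq_iff forall_2)
  then show "\<exists>s. x = cyclic_submodule (vector [s, 1])"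
    using ab(2) cyclic_submodule_scaled[OF c(2)] by metis
next
  assume "\<exists>s. x = cyclic_submodule (vector [s, 1])"
  then show "distant x base_point"
    by (auto simp: distant_cyclic_submodule_iff admissible_pair_1d admissible_pair_s1
        invertible_mat2_lower_10 two_sided_unit_def simp flip: mat2_def)
qed

lemma radically_parallel_base_point_iff:
  fixes q :: "('a::ring_1^2) set"
  shows "radically_parallel base_point q \<longleftrightarrow>
    (\<exists>d\<in>jacobson_radical. q = cyclic_submodule (vector [1, d]))"
proof -
  \<comment> \<open>Only the points \<open>R(s,1)\<close> have to be tested, and each test is the
    invertibility of the matrix with rows \<open>(s,1)\<close> and \<open>(c,d)\<close>.\<close>
  have coord: "radically_parallel base_point (cyclic_submodule (vector [c, d])) \<longleftrightarrow>
      (\<forall>s. two_sided_unit (c - d * s))" if cd: "admissible_pair (vector [c, d])" for c d :: 'a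
  proof -
    have "radically_parallel base_point (cyclic_submodule (vector [c, d])) \<longleftrightarrow>
        (\<forall>s. distant (cyclic_submodule (vector [s, 1])) (cyclic_submodule (vector [c, d])))"
      unfolding radically_parallel_def
      using cyclic_submodule_in_projective_line[OF cd]
        cyclic_submodule_in_projective_line[OF admissible_pair_1d[of 0]]
        cyclic_submodule_in_projective_line[OF admissible_pair_s1]
      by (metis distant_base_point_iff)
    then show ?thesis
      by (simp add: distant_cyclic_submodule_iff cd admissible_pair_s1 invertible_mat2_upper_s1
          flip: mat2_def)
  qed
  show ?thesis
  proof
    assume par: "radically_parallel base_point q"
    then obtain c d where cd: "admissible_pair (vector [c, d])" "q = cyclic_submodule (vector [c, d])"
      unfolding radically_parallel_def by (blast elim: projective_line_cases)
    then have units: "two_sided_unit (c - d * s)" for s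
      using par coord by blast
    \<comment> \<open>At \<open>s = 0\<close> the condition says that \<open>c\<close> is a unit;
      its inverse \<open>e\<close> normalises the generator to \<open>(1, e * d)\<close>.\<close>
    from units[of 0] obtain e where e: "e * c = 1" "two_sided_unit e"
      unfolding two_sided_unit_def by auto
    have "two_sided_unit (1 - (e * d) * s)" for s
    proof -
      have "1 - e * d * s = e * (c - d * s)"
        using e(1) by (simp add: algebra_simps)
      then show ?thesis
        using units two_sided_unit_mult_left_cancel[OF e(2)] by simp
    qed
    then have "e * d \<in> jacobson_radical"
      unfolding jacobson_radical_iff_two_sided_unit by blast
    moreover have "q = cyclic_submodule (vector [1, e * d])"
    proof -
      have "vector [1, e * d] = e *s (vector [c, d] :: 'a^2)"
        using e(1) by (simp add: vec_eq_iff forall_2)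
      then show ?thesis
        using cd(2) cyclic_submodule_scaled[OF e(2)] by metis
    qed
    ultimately show "\<exists>d\<in>jacobson_radical. q = cyclic_submodule (vector [1, d])"
      by blast
  next
    assume "\<exists>d\<in>jacobson_radical. q = cyclic_submodule (vector [1, d])"
    then show "radically_parallel base_point q"
      using coord[OF admissible_pair_1d] jacobson_radical_iff_two_sided_unit by blast
  qed
qed

text \<open>The definition is a one-sided implication, so symmetry is not formal: it rests on the
  radical being closed under negation.\<close>

lemma radically_parallel_sym:
  assumes pq: "radically_parallel p q"
  shows "radically_parallel q p"
proof -
  obtain A where A: "invertible A" "p = (\<lambda>v. v v* A) ` base_point"
    using pq projective_line_transitive unfolding radically_parallel_def by metis
  obtain B where AB: "A ** B = mat 1" "B ** A = mat 1"
    using A(1) unfolding invertible_def by blast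
  then have "invertible B"
    unfolding invertible_def by blast
  from radically_parallel_image[OF pq this]
  have "radically_parallel base_point ((\<lambda>v. v v* B) ` q)"
    using A(2) by (simp add: image_vector_matrix_mult_inverse[OF AB(1)])
  then obtain d where d: "d \<in> jacobson_radical"
    and q: "(\<lambda>v. v v* B) ` q = cyclic_submodule (vector [1, d])"
    unfolding radically_parallel_base_point_iff by blast
  \<comment> \<open>The element equals \<open>1 - d * (- s)\<close>, so the criterion for
    \<open>d\<close> applies at \<open>- s\<close>.\<close>
  have "two_sided_unit (1 - (- d) * s)" for s
    using d jacobson_radical_iff_two_sided_unit[of d] by (metis minus_mult_commute)
  then have "- d \<in> jacobson_radical"
    unfolding jacobson_radical_iff_two_sided_unit by blast
  then have "radically_parallel base_point (cyclic_submodule (vector [1, - d]))"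
    unfolding radically_parallel_base_point_iff by blast
  \<comment> \<open>This matrix sends \<open>(1,0)\<close> to \<open>(1,d)\<close> and
    \<open>(1,-d)\<close> to \<open>(1,0)\<close>, which exchanges the roles of the two
    points.\<close>
  from radically_parallel_image[OF this invertible_mat2_upper_unitriangular[of d]]
  have "radically_parallel (cyclic_submodule (vector [1, 0] v* mat2 1 d 0 1))
      (cyclic_submodule (vector [1, - d] v* mat2 1 d 0 1))"
    by (simp only: image_vector_matrix_mult_cyclic_submodule)
  moreover have "vector [1, 0] v* mat2 1 d 0 1 = vector [1, d]"
    "vector [1, - d] v* mat2 1 d 0 1 = vector [1, 0]"
    by (simp_all add: vector_matrix_mult_def mat2_def vec_eq_iff forall_2 sum_2)
  ultimately have "radically_parallel (cyclic_submodule (vector [1, d])) base_point"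
    by simp
  from radically_parallel_image[OF this A(1)] show ?thesis
    using A(2) by (simp add: image_vector_matrix_mult_inverse[OF AB(2)] flip: q)
qed

section \<open>Size of the parallel classes\<close>

lemma inj_cyclic_submodule_1d: "inj (\<lambda>d. cyclic_submodule (vector [1, d]) :: ('a::ring_1^2) set)"
proof (rule injI)
  fix d e :: 'a
  assume eq: "cyclic_submodule (vector [1, d]) = (cyclic_submodule (vector [1, e]) :: ('a^2) set)"
  obtain w where "vector [1, d] = w *s (vector [1, e] :: 'a^2)"
    by (rule admissible_pair_unique_up_to_unit[OF admissible_pair_1d admissible_pair_1d eq])
  \<comment> \<open>Comparing first coordinates gives \<open>w = 1\<close>.\<close>
  then show "d = e"
    by (simp add: vec_eq_iff forall_2)
qed

text \<open>A matrix taking \<open>R(1,0)\<close> to \<open>p\<close> carries the points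
  \<open>R(1,d)\<close> with \<open>d\<close> in the radical bijectively onto the class of
  \<open>p\<close>. Symmetry is needed because the class collects the points parallel to
  \<open>p\<close>, while the description at \<open>R(1,0)\<close> has the base point on the
  left.\<close>

lemma radical_parallel_class_eqpoll:
  fixes p :: "('a::ring_1^2) set"
  assumes "p \<in> projective_line"
  shows "{x \<in> projective_line. radically_parallel x p} \<approx> (jacobson_radical :: 'a set)"
proof -
  obtain A where A: "invertible A" "p = (\<lambda>v. v v* A) ` base_point"
    using projective_line_transitive[OF assms] .
  obtain B where AB: "A ** B = mat 1" "B ** A = mat 1"
    using A(1) unfolding invertible_def by blast
  then have B: "invertible B"
    unfolding invertible_def by blast
  define f where "f d = (\<lambda>v. v v* A) ` cyclic_submodule (vector [1, d])" for d
  have "inj f"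
    unfolding f_def using inj_cyclic_submodule_1d image_vector_matrix_mult_inverse[OF AB(1)]
    by (metis (mono_tags, lifting) injD injI)
  moreover have "{x \<in> projective_line. radically_parallel x p} = f ` jacobson_radical"
  proof (intro equalityI subsetI)
    fix x assume "x \<in> {x \<in> projective_line. radically_parallel x p}"
    then have "radically_parallel p x"
      by (simp add: radically_parallel_sym)
    from radically_parallel_image[OF this B]
    have "radically_parallel base_point ((\<lambda>v. v v* B) ` x)"
      using A(2) by (simp add: image_vector_matrix_mult_inverse[OF AB(1)])
    then obtain d where "d \<in> jacobson_radical"
      "(\<lambda>v. v v* B) ` x = cyclic_submodule (vector [1, d])"
      unfolding radically_parallel_base_point_iff by blast
    then show "x \<in> f ` jacobson_radical"
      unfolding f_def using image_vector_matrix_mult_inverse[OF AB(2), of x] by blast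
  next
    fix x assume "x \<in> f ` jacobson_radical"
    then have "radically_parallel p x"
      unfolding f_def A(2)
      using radically_parallel_base_point_iff radically_parallel_image[OF _ A(1)] by blast
    then show "x \<in> {x \<in> projective_line. radically_parallel x p}"
      using radically_parallel_sym unfolding radically_parallel_def by blast
  qed
  ultimately show ?thesis
    by (simp add: inj_on_image_eqpoll_self inj_on_subset)
qed

theorem mainTheorem6:
  shows "(\<forall>p \<in> (projective_line :: ('a::ring_1^2) set set).
            {x \<in> projective_line. radically_parallel x p} \<approx> (jacobson_radical :: 'a set)) \<and>
         ((\<forall>p \<in> (projective_line :: ('a^2) set set). \<forall>q \<in> projective_line.
             radically_parallel p q \<longleftrightarrow> p = q)
          \<longleftrightarrow> (jacobson_radical :: 'a set) = {0})"
proof (intro conjI ballI iffI)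
  show "{x \<in> projective_line. radically_parallel x p} \<approx> (jacobson_radical :: 'a set)"
    if "p \<in> projective_line" for p :: "('a^2) set"
    using that by (rule radical_parallel_class_eqpoll)
next
  assume eq: "\<forall>p \<in> (projective_line :: ('a^2) set set). \<forall>q \<in> projective_line.
    radically_parallel p q \<longleftrightarrow> p = q"
  have base: "(base_point :: ('a^2) set) \<in> projective_line"
    by (rule cyclic_submodule_in_projective_line[OF admissible_pair_1d])
  have "d = 0" if "d \<in> jacobson_radical" for d :: 'a
  proof -
    have "radically_parallel base_point (cyclic_submodule (vector [1, d]))"
      using that radically_parallel_base_point_iff by blast
    then have "base_point = cyclic_submodule (vector [1, d])"
      using eq base unfolding radically_parallel_def by blast
    then show ?thesis
      using injD[OF inj_cyclic_submodule_1d] by metis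
  qed
  moreover have "(0 :: 'a) \<in> jacobson_radical"
    by (simp add: jacobson_radical_iff_two_sided_unit two_sided_unit_def)
  ultimately show "(jacobson_radical :: 'a set) = {0}"
    by blast
next
  fix p q :: "('a^2) set"
  assume rad: "(jacobson_radical :: 'a set) = {0}"
    and pq: "p \<in> projective_line" "q \<in> projective_line"
  have refl: "radically_parallel q q"
    using pq(2) unfolding radically_parallel_def by blast
  show "p = q" if "radically_parallel p q"
  proof -
    \<comment> \<open>The class of \<open>q\<close> has a single element, yet contains both
      \<open>p\<close> and \<open>q\<close>.\<close>
    have "{x \<in> projective_line. radically_parallel x q} \<approx> {0 :: 'a}"
      using radical_parallel_class_eqpoll[OF pq(2)] rad by simp
    then obtain y where "{x \<in> projective_line. radically_parallel x q} = {y}"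
      by (auto simp: eqpoll_singleton_iff)
    then show ?thesis
      using that refl pq by blast
  qed
  show "radically_parallel p q" if "p = q"
    using that refl by simp
qed

end
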